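(* $\mathrm{fp}(2)=3$. That is, the supremum over all $b>0$ and $(a_1,a_2,r_1,r_2)\in\mathbb{R}^4$ of the number of connected components of the solution set $$\{x\in I_2(a,r)\;:\;a_2+(a_1+x^{r_1})^{r_2}-b\,x=0\}$$ is equal to $3$.
   Context: $I_2(a,r)\subset\mathbb{R}$ is the (possibly empty) open interval of all real $x$ for which the functions $g_0(x)=x$, $g_1(x)=a_1+x^{r_1}$, $g_2(x)=a_2+g_1(x)^{r_2}$ are all defined and strictly positive. The real powers are the usual ones of positive real numbers. *)

theory Defs
  imports "HOL-Analysis.Analysis" "HOL-Library.Extended_Nat"
begin

definition g1 :: "real \<Rightarrow> real \<Rightarrow> real \<Rightarrow> real" where
  "g1 a1 r1 x = a1 + x powr r1"

definition g2 :: "real \<Rightarrow> real \<Rightarrow> real \<Rightarrow> real \<Rightarrow> real \<Rightarrow> real" where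
  "g2 a1 a2 r1 r2 x = a2 + g1 a1 r1 x powr r2"

(* On I2 every base of a power is positive, so powr is the usual real power there
   and its junk values at nonpositive bases play no role. *)
definition I2 :: "real \<Rightarrow> real \<Rightarrow> real \<Rightarrow> real \<Rightarrow> real set" where
  "I2 a1 a2 r1 r2 = {x. 0 < x \<and> 0 < g1 a1 r1 x \<and> 0 < g2 a1 a2 r1 r2 x}"

definition sols2 :: "real \<Rightarrow> real \<Rightarrow> real \<Rightarrow> real \<Rightarrow> real \<Rightarrow> real set" where
  "sols2 b a1 a2 r1 r2 =
    {x \<in> I2 a1 a2 r1 r2. a2 + (a1 + x powr r1) powr r2 - b * x = 0}"

(* Valued in enat because card alone would count infinitely many components as 0. *)
definition num_components :: "'a::topological_space set \<Rightarrow> enat" where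
  "num_components S =
    (if finite (components S) then enat (card (components S)) else \<infinity>)"

definition fp2 :: enat where
  "fp2 = Sup {num_components (sols2 b a1 a2 r1 r2) | b a1 a2 r1 r2. b > 0}"

end

theory Submission
  imports Defs
begin

text \<open>The zeros of \<open>F x = a2 + (a1 + x powr r1) powr r2 - b * x\<close> are counted by Rolle's theorem, applied twice.
  The critical points of \<open>F\<close> are, after taking logarithms, the points of one level set of
  \<open>H x = (r1 - 1) * ln x + (r2 - 1) * ln (a1 + x powr r1)\<close>, and \<open>H'\<close> vanishes exactly where
  \<open>(r1 - 1) * a1 + (r1 * r2 - 1) * x powr r1 = 0\<close>. Four zeros of \<open>F\<close> give two zeros of \<open>H'\<close>, which forces
  \<open>r1 * r2 = 1\<close> and \<open>(r1 - 1) * a1 = 0\<close>; then \<open>F\<close> is affine, hence identically zero. The bound is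
  attained by \<open>x\<^sup>2 / (1 + x\<^sup>2) + 1/10 = 3/5 * x\<close>, with roots 1/3, 1/2 and 1.\<close>

lemma components_finite:
  fixes S :: "'a::metric_space set"
  assumes "finite S"
  shows "components S = (\<lambda>x. {x}) ` S"
proof -
  have "connected_component_set S x = {x}" if x: "x \<in> S" for x
  proof -
    have "finite (connected_component_set S x)"
      using assms connected_component_subset finite_subset by metis
    moreover have "x \<in> connected_component_set S x"
      using x by simp
    moreover have "connected (connected_component_set S x)"
      by (rule connected_connected_component)
    ultimately show ?thesis
      using connected_finite_iff_sing by (metis empty_iff singletonD)
  qed
  then show ?thesis
    by (auto simp: components_def)
qed

lemma num_components_finite:
  fixes S :: "'a::metric_space set"
  assumes "finite S"
  shows "num_components S = enat (card S)"
  using assms by (simp add: num_components_def components_finite card_image)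

text \<open>Only a bound, since the empty set is connected and has no component.\<close>

lemma num_components_connected_le:
  assumes "connected S"
  shows "num_components S \<le> 1"
proof (cases "S = {}")
  case True
  then show ?thesis by (simp add: num_components_def flip: zero_enat_def)
next
  case False
  then have "components S = {S}"
    using assms by (simp add: connected_eq_components_subset_sing_exists components_eq_sing_iff)
  then show ?thesis by (simp add: num_components_def one_enat_def)
qed

text \<open>The negated conjunction also admits infinite \<open>S\<close>, for which
  \<open>card S\<close> is 0.\<close>

lemma obtain_four_increasing:
  fixes S :: "'a::linorder set"
  assumes "\<not> (finite S \<and> card S \<le> 3)"
  obtains x1 x2 x3 x4
  where "{x1, x2, x3, x4} \<subseteq> S" "x1 < x2" "x2 < x3" "x3 < x4"
proof -
  obtain T where T: "T \<subseteq> S" "finite T" "card T = 4"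
  proof (cases "finite S")
    case True
    then have "4 \<le> card S" using assms by simp
    then show ?thesis using obtain_subset_with_card_n that by metis
  next
    case False
    then show ?thesis using infinite_arbitrarily_large that by metis
  qed
  define xs where "xs = sorted_list_of_set T"
  have xs: "sorted_wrt (<) xs" "set xs = T" "length xs = 4"
    using T by (simp_all add: xs_def)
  then obtain x1 x2 x3 x4 where "xs = [x1, x2, x3, x4]"
    by (auto simp: numeral_eq_Suc length_Suc_conv)
  with xs T show ?thesis by (intro that[of x1 x2 x3 x4]) auto
qed

text \<open>On the positive reals \<open>x powr r\<close> is monotone, in a direction given by the
  sign of \<open>r\<close>, so between two points \<open>g1\<close> is at least its value at one of
  them.\<close>

lemma is_interval_g1_pos: "is_interval {x. 0 < x \<and> 0 < g1 a r x}"
proof (unfold is_interval_1, intro ballI allI impI)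
  fix x y z :: real
  assume "x \<in> {x. 0 < x \<and> 0 < g1 a r x}" "y \<in> {x. 0 < x \<and> 0 < g1 a r x}"
    and "x \<le> z \<and> z \<le> y"
  then have *: "0 < x" "0 < a + x powr r" "0 < a + y powr r" "x \<le> z" "z \<le> y"
    by (auto simp: g1_def)
  have "0 < a + z powr r"
  proof (cases "0 \<le> r")
    case True
    then have "x powr r \<le> z powr r" using * by (simp add: powr_mono2)
    with * show ?thesis by linarith
  next
    case False
    then have "y powr r \<le> z powr r" using * by (simp add: powr_mono2')
    with * show ?thesis by linarith
  qed
  with * show "z \<in> {x. 0 < x \<and> 0 < g1 a r x}" by (simp add: g1_def)
qed

lemma Rolle_interval:
  fixes f f' :: "real \<Rightarrow> real"
  assumes "is_interval J" "\<And>x. x \<in> J \<Longrightarrow> (f has_real_derivative f' x) (at x)"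
    and "x \<in> J" "y \<in> J" "x < y" "f x = f y"
  obtains z where "z \<in> J" "x < z" "z < y" "f' z = 0"
proof -
  have J: "u \<in> J" if "x \<le> u" "u \<le> y" for u
    using assms that unfolding is_interval_1 by blast
  have "\<exists>z. x < z \<and> z < y \<and> (\<lambda>v. f' z * v) = (\<lambda>v. 0)"
  proof (rule Rolle_deriv[OF \<open>x < y\<close> \<open>f x = f y\<close>])
    show "continuous_on {x..y} f"
      using J assms(2)
      by (metis atLeastAtMost_iff DERIV_isCont continuous_at_imp_continuous_on)
    show "(f has_derivative (\<lambda>v. f' z * v)) (at z)" if "x < z" "z < y" for z
      using assms(2)[OF J[of z]] that by (simp add: has_field_derivative_def)
  qed
  then obtain z where "x < z" "z < y" "f' z = 0"
    by (metis mult.right_neutral)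
  then show ?thesis using J that by simp
qed

text \<open>At a zero \<open>g2\<close> equals \<open>b * x\<close>, which is positive. Zeros can
  thus be studied on the set that \<open>is_interval_g1_pos\<close> shows to be an interval.\<close>

lemma sols2_eq:
  assumes "b > 0"
  shows "sols2 b a1 a2 r1 r2 =
    {x. 0 < x \<and> 0 < g1 a1 r1 x \<and> a2 + (a1 + x powr r1) powr r2 - b * x = 0}"
proof -
  have "0 < g2 a1 a2 r1 r2 x" if "0 < x" "a2 + (a1 + x powr r1) powr r2 - b * x = 0" for x
  proof -
    have "g2 a1 a2 r1 r2 x = b * x" using that by (simp add: g1_def g2_def)
    then show ?thesis using assms that by simp
  qed
  then show ?thesis by (auto simp: sols2_def I2_def)
qed

text \<open>The degenerate case: the equation is affine on the interval \<open>J\<close>, so two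
  distinct zeros force it to hold on all of \<open>J\<close>.\<close>

lemma sols2_affine:
  assumes b: "b > 0" and r: "r1 * r2 = 1" "(r1 - 1) * a1 = 0"
    and xy: "x \<in> sols2 b a1 a2 r1 r2" "y \<in> sols2 b a1 a2 r1 r2" "x \<noteq> y"
  shows "connected (sols2 b a1 a2 r1 r2)"
proof -
  define J where "J = {x. 0 < x \<and> 0 < g1 a1 r1 x}"
  \<comment> \<open>Either \<open>a1 = 0\<close> and the exponents cancel, or \<open>r1 = 1\<close>
    and hence \<open>r2 = 1\<close>.\<close>
  have affine: "(a1 + u powr r1) powr r2 = a1 + u" if "u \<in> J" for u
    using r that by (cases "a1 = 0") (auto simp: J_def g1_def powr_powr)
  have zero: "u \<in> sols2 b a1 a2 r1 r2 \<longleftrightarrow> u \<in> J \<and> a2 + a1 + (1 - b) * u = 0" for u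
    using affine[of u] by (auto simp: sols2_eq[OF b] J_def algebra_simps)
  have "(1 - b) * (x - y) = 0" using xy by (simp add: zero algebra_simps)
  then have "b = 1" using \<open>x \<noteq> y\<close> by simp
  then have "sols2 b a1 a2 r1 r2 = J" using zero xy(1) by auto
  then show ?thesis
    unfolding J_def using is_interval_g1_pos is_interval_connected_1 by metis
qed

lemma sols2_four_zeros:
  assumes b: "b > 0"
    and x: "{x1, x2, x3, x4} \<subseteq> sols2 b a1 a2 r1 r2" "x1 < x2" "x2 < x3" "x3 < x4"
  shows "r1 * r2 = 1" "(r1 - 1) * a1 = 0"
proof -
  define J where "J = {x. 0 < x \<and> 0 < a1 + x powr r1}"
  have J: "is_interval J"
    using is_interval_g1_pos[of a1 r1] by (simp add: J_def g1_def)
  define F where "F = (\<lambda>x. a2 + (a1 + x powr r1) powr r2 - b * x)"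
  define F' where
    "F' = (\<lambda>x. r1 * r2 * (x powr (r1 - 1) * (a1 + x powr r1) powr (r2 - 1)) - b)"
  define H where "H = (\<lambda>x. (r1 - 1) * ln x + (r2 - 1) * ln (a1 + x powr r1))"
  define H' where
    "H' = (\<lambda>x. (r1 - 1) * (1 / x) + (r2 - 1) * (r1 * x powr (r1 - 1) / (a1 + x powr r1)))"
  have F: "(F has_real_derivative F' u) (at u)" if "u \<in> J" for u
    using that unfolding F_def F'_def J_def
    by (auto intro!: derivative_eq_intros simp: powr_diff mult_ac)
  have H: "(H has_real_derivative H' u) (at u)" if "u \<in> J" for u
    using that unfolding H_def H'_def J_def
    by (auto intro!: derivative_eq_intros simp: powr_diff mult_ac)
  have x': "u \<in> J \<and> F u = 0" if "u \<in> {x1, x2, x3, x4}" for u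
    using x(1) that by (auto simp: sols2_eq[OF b] J_def F_def g1_def)
  obtain y1 where y1: "y1 \<in> J" "y1 < x2" "F' y1 = 0"
    using Rolle_interval[OF J F, of x1 x2] x x' by auto
  obtain y2 where y2: "y2 \<in> J" "x2 < y2" "y2 < x3" "F' y2 = 0"
    using Rolle_interval[OF J F, of x2 x3] x x' by auto
  obtain y3 where y3: "y3 \<in> J" "x3 < y3" "F' y3 = 0"
    using Rolle_interval[OF J F, of x3 x4] x x' by auto
  \<comment> \<open>Keeping \<open>exp\<close> avoids taking the logarithm of
    \<open>b / (r1 * r2)\<close> before its sign is known.\<close>
  have crit: "r1 * r2 * exp (H u) = b" if "u \<in> J" "F' u = 0" for u
  proof -
    have "0 < u" "0 < a1 + u powr r1" using \<open>u \<in> J\<close> by (simp_all add: J_def)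
    then have "exp (H u) = u powr (r1 - 1) * (a1 + u powr r1) powr (r2 - 1)"
      by (simp add: H_def exp_add powr_def[of u "r1 - 1"] powr_def[of _ "r2 - 1"])
    then show ?thesis using that by (simp add: F'_def)
  qed
  \<comment> \<open>This serves twice: to cancel the factor in \<open>level\<close>, and to make
    \<open>z powr r1\<close> injective in \<open>z\<close>.\<close>
  have r0: "r1 * r2 \<noteq> 0" using crit[OF y1(1,3)] b by auto
  have level: "H u = H v" if "u \<in> J" "F' u = 0" "v \<in> J" "F' v = 0" for u v
  proof -
    have "r1 * r2 * exp (H u) = r1 * r2 * exp (H v)" using crit that by simp
    then show ?thesis using r0 by simp
  qed
  obtain z1 where z1: "z1 \<in> J" "z1 < y2" "H' z1 = 0"
    using Rolle_interval[OF J H, of y1 y2] level[of y1 y2] y1 y2 by auto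
  obtain z2 where z2: "z2 \<in> J" "y2 < z2" "H' z2 = 0"
    using Rolle_interval[OF J H, of y2 y3] level[of y2 y3] y2 y3 by auto
  \<comment> \<open>Clearing the positive denominators \<open>z\<close> and
    \<open>a1 + z powr r1\<close> leaves an equation affine in \<open>z powr r1\<close>. Two
    distinct values of that power, at \<open>z1 < y2 < z2\<close>, make both coefficients
    vanish.\<close>
  have lin: "(r1 - 1) * a1 + (r1 * r2 - 1) * z powr r1 = 0" if "z \<in> J" "H' z = 0" for z
  proof -
    have pos: "0 < z" "0 < a1 + z powr r1" using \<open>z \<in> J\<close> by (simp_all add: J_def)
    have "H' z = ((r1 - 1) + (r2 - 1) * (r1 * z powr r1 / (a1 + z powr r1))) / z"
      using pos by (simp add: H'_def powr_diff add_divide_distrib mult_ac)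
    then have "(r1 - 1) + (r2 - 1) * (r1 * z powr r1 / (a1 + z powr r1)) = 0"
      using that pos by simp
    then have "(r1 - 1) * (a1 + z powr r1) + (r2 - 1) * (r1 * z powr r1) = 0"
      using pos by (simp add: divide_simps mult_ac)
    then show ?thesis by (simp add: algebra_simps)
  qed
  have "z1 powr r1 \<noteq> z2 powr r1"
  proof
    assume "z1 powr r1 = z2 powr r1"
    then have "ln (z1 powr r1) = ln (z2 powr r1)" by simp
    then show False using z1 z2 r0 by (simp add: J_def ln_powr)
  qed
  moreover have "(r1 * r2 - 1) * (z1 powr r1 - z2 powr r1) = 0"
    using lin[OF z1(1,3)] lin[OF z2(1,3)] by (simp add: algebra_simps)
  ultimately show "r1 * r2 = 1" by simp
  then show "(r1 - 1) * a1 = 0" using lin[OF z1(1,3)] by simp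
qed

text \<open>The connected alternative absorbs the infinite solution sets, which then contribute a
  single component.\<close>

lemma sols2_finite_or_connected:
  assumes "b > 0"
  shows "connected (sols2 b a1 a2 r1 r2) \<or>
    finite (sols2 b a1 a2 r1 r2) \<and> card (sols2 b a1 a2 r1 r2) \<le> 3"
proof (rule disjCI)
  assume "\<not> (finite (sols2 b a1 a2 r1 r2) \<and> card (sols2 b a1 a2 r1 r2) \<le> 3)"
  then obtain x1 x2 x3 x4
    where x: "{x1, x2, x3, x4} \<subseteq> sols2 b a1 a2 r1 r2" "x1 < x2" "x2 < x3" "x3 < x4"
    by (rule obtain_four_increasing)
  show "connected (sols2 b a1 a2 r1 r2)"
    using sols2_affine[OF assms sols2_four_zeros[OF assms x], of x1 a2 x2] x by simp
qed

lemma num_components_sols2_le: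
  assumes "b > 0"
  shows "num_components (sols2 b a1 a2 r1 r2) \<le> 3"
  using sols2_finite_or_connected[OF assms, of a1 a2 r1 r2]
proof
  assume "connected (sols2 b a1 a2 r1 r2)"
  then have "num_components (sols2 b a1 a2 r1 r2) \<le> 1"
    by (rule num_components_connected_le)
  also have "(1::enat) \<le> 3" by simp
  finally show ?thesis .
next
  assume "finite (sols2 b a1 a2 r1 r2) \<and> card (sols2 b a1 a2 r1 r2) \<le> 3"
  then show ?thesis by (simp add: num_components_finite numeral_eq_enat)
qed

text \<open>With these exponents and \<open>a1 = 1\<close>, clearing denominators gives
  \<open>b * x^3 - (a2 + 1) * x^2 + b * x - a2 = 0\<close>. The equal coefficients of
  \<open>x^3\<close> and \<open>x\<close> require roots whose pairwise products sum to 1, as 1/2 +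
  1/3 + 1/6 does. The sum 11/6 and the product 1/6 of the roots then give \<open>b = 3/5\<close> and
  \<open>a2 = 1/10\<close>.\<close>

lemma sols2_example: "sols2 (3/5) 1 (1/10) (-2) (-1) = {1/3, 1/2, 1}"
proof -
  have zero: "1 / 10 + (1 + x powr -2) powr -1 - 3 / 5 * x = 0
      \<longleftrightarrow> (3 * x - 1) * (2 * x - 1) * (x - 1) = 0" if "0 < x" for x :: real
  proof -
    have pos: "0 < 1 + x\<^sup>2" by (simp add: add_pos_nonneg)
    have "(1 + x powr -2) powr -1 = inverse (1 + inverse (x\<^sup>2))"
      using that by (simp add: powr_minus powr_numeral)
    also have "\<dots> = x\<^sup>2 / (1 + x\<^sup>2)"
      using that pos by (simp add: divide_simps)
    finally have eq: "(1 + x powr -2) powr -1 = x\<^sup>2 / (1 + x\<^sup>2)" .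
    have "(1 / 10 + x\<^sup>2 / (1 + x\<^sup>2) - 3 / 5 * x) * (10 * (1 + x\<^sup>2))
        = (1 - 6 * x) * (1 + x\<^sup>2) + 10 * (x\<^sup>2 / (1 + x\<^sup>2) * (1 + x\<^sup>2))"
      by (simp only: algebra_simps)
    also have "x\<^sup>2 / (1 + x\<^sup>2) * (1 + x\<^sup>2) = x\<^sup>2"
      using pos by simp
    also have "(1 - 6 * x) * (1 + x\<^sup>2) + 10 * x\<^sup>2 = - ((3 * x - 1) * (2 * x - 1) * (x - 1))"
      by algebra
    finally have "(1 / 10 + x\<^sup>2 / (1 + x\<^sup>2) - 3 / 5 * x) * (10 * (1 + x\<^sup>2)) = 0
        \<longleftrightarrow> (3 * x - 1) * (2 * x - 1) * (x - 1) = 0"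
      by (simp only: neg_equal_0_iff_equal)
    moreover have "10 * (1 + x\<^sup>2) \<noteq> 0" using mult_pos_pos[of 10, OF _ pos] by linarith
    ultimately show ?thesis unfolding eq by (simp only: mult_eq_0_iff simp_thms)
  qed
  have pos: "0 < g1 1 (-2) x" for x by (simp add: g1_def add_pos_nonneg)
  have "sols2 (3/5) 1 (1/10) (-2) (-1)
      = {x. 0 < x \<and> (3 * x - 1) * (2 * x - 1) * (x - 1) = 0}"
    by (subst sols2_eq, simp) (simp only: zero pos simp_thms cong: conj_cong)
  also have "\<dots> = {1/3, 1/2, 1}"
  proof -
    have "3 * x - 1 = 0 \<longleftrightarrow> x = 1/3" "2 * x - 1 = 0 \<longleftrightarrow> x = 1/2" "x - 1 = 0 \<longleftrightarrow> x = 1"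
      for x :: real
      by linarith+
    then show ?thesis by (simp only: mult_eq_0_iff) fastforce
  qed
  finally show ?thesis .
qed

theorem mainTheorem4:
  shows "fp2 = 3"
proof (rule antisym)
  show "fp2 \<le> 3"
    unfolding fp2_def by (rule Sup_least) (auto intro: num_components_sols2_le)
  have "num_components (sols2 (3/5) 1 (1/10) (-2) (-1)) = 3"
    by (simp add: sols2_example num_components_finite numeral_eq_enat)
  \<comment> \<open>This has the shape of membership in the set under \<open>Sup\<close>.\<close>
  then have "3 = num_components (sols2 (3/5) 1 (1/10) (-2) (-1)) \<and> (0::real) < 3/5"
    by simp
  then show "3 \<le> fp2"
    unfolding fp2_def by (intro Sup_upper) blast
qed

end
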